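(* Let $C=\prod_{j\ge1}(1+2^{1-2^{j-1}})\approx3.40147$. With $n_H=\lceil n/2\rceil$, $n_L=\lfloor n/2\rfloor$, the routing-added CNOT depth $D^{\mathrm{GPF}\text{-}2\mathrm L}_{\mathrm{route}}(n)$ of the complete $\mathrm{GPF}(n)$ compiled on the $2\times n_H$ nearest-neighbor grid satisfies the recurrences $$\begin{aligned} D^{\mathrm{GPF}\text{-}2\mathrm L}_{\mathrm{route}}(n)&=3\mu_{\mathrm{jump}}2^{n_H}D^{\mathrm{GPF}^*}_z(n_L)+D^{\mathrm{GPF}\text{-}1\mathrm L}_{\mathrm{route}}(n_H,0)+D^{\mathrm{GPF}^*\text{-}1\mathrm L}_{\mathrm{route}}(n_L,0),\\ D^{\mathrm{GPF}\text{-}1\mathrm L}_{\mathrm{route}}(n,r)&=6\mu_{\mathrm{jump}}2^{r}2^{n_H}D^{\mathrm{GPF}^*}_z(n_L)+D^{\mathrm{GPF}\text{-}1\mathrm L}_{\mathrm{route}}(n_H,r+1)+D^{\mathrm{GPF}^*\text{-}1\mathrm L}_{\mathrm{route}}(n_L,r+1),\\ D^{\mathrm{GPF}^*\text{-}1\mathrm L}_{\mathrm{route}}(n,r)&=6\mu_{\mathrm{jump}}2^{r}2^{n_H}D^{\mathrm{GPF}^*}_z(n_L)+D^{\mathrm{GPF}^*\text{-}1\mathrm L}_{\mathrm{route}}(n_H,r+1)+D^{\mathrm{GPF}^*\text{-}1\mathrm L}_{\mathrm{route}}(n_L,r+1), \end{aligned}$$ where all three quantities are $0$ for $n\le 2$.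 The normalized depth $D^{\mathrm{GPF}\text{-}2\mathrm L}_{\mathrm{route}}(n)/(2^n/n)$ oscillates in sawtooth fashion, with minima at $n=2^\lambda$ and maxima at $n=2^{\lambda+1}-1$ within each dyadic interval $[2^\lambda,2^{\lambda+1})$, converging respectively (as $\lambda\to\infty$, with $n$ the argument of the depth function) to $$\frac{D^{\mathrm{GPF}\text{-}2\mathrm L}_{\mathrm{route}}(2^\lambda)}{2^n/n}\to 3\mu_{\mathrm{jump}}C\approx10.82,\qquad \frac{D^{\mathrm{GPF}\text{-}2\mathrm L}_{\mathrm{route}}(2^\lambda-1)}{2^n/n}\to3\mu_{\mathrm{jump}}\cdot2(C-1)\approx15.27,$$ the numerical values being for $\mu_{\mathrm{jump}}\approx1.06$.
   Context: $D^{\mathrm{GPF}^*}_z$ is defined by $D^{\mathrm{GPF}^*}_z(1)=1$ and $D^{\mathrm{GPF}^*}_z(n)=2^{n_H-1}D^{\mathrm{GPF}^*}_z(n_L)+D^{\mathrm{GPF}^*}_z(n_H)$ for $n\ge2$. Setting. $\mathrm{GPF}(n)$ is a recursive ancilla-free circuit family over CNOT and phase gates for $n$-qubit diagonal unitaries. The qubits are split into $n_H$ high qubits and $n_L$ low qubits. $\mathrm{GPF}(n)$ consists of (i) $D^{\mathrm{GPF}^*}_z(n_L)$ top-level mixing blocks GPS between the two halves, (ii) a recursive $\mathrm{GPF}(n_H)$ on the high qubits, and (iii) a recursive $\mathrm{GPF}^*(n_L)$ on the low qubits; $\mathrm{GPF}^*(n)$ likewise consists of $D^{\mathrm{GPF}^*}_z(n_L)$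 mixing blocks $\mathrm{GPS}^*$ and recursive $\mathrm{GPF}^*(n_H)$, $\mathrm{GPF}^*(n_L)$. A GPS block of high width $w$ executes, for $t=0,\dots,2^w-1$, a parallel layer of CNOTs with control high qubit $(f_t+j)\bmod w$ and target low qubit $j$, where $G=(f_0,\dots,f_{2^w-1})$ is a closed Gray-code transition sequence on $w$ coordinates (successively flipping the listed coordinates visits every element of $\mathbb F_2^w$ once and returns to $0$); $\mathrm{GPS}^*$ is a forward–reverse variant with the same routing geometry. Jump density: $\mu_{\mathrm{jump}}(G)=2^{-w}\sum_{t}\mathrm{Dist}_w(f_t,f_{(t+1)\bmod 2^w})$ with $\mathrm{Dist}_w(a,b)=\min(|a-b|,w-|a-b|)$. It is written as a single constant $\mu_{\mathrm{jump}}$ for all blocks. Compilation. Only nearest-neighbor two-qubit gates are allowed; a SWAP counts as 3 CNOTs (depth 3). The two halves of the top level are placed on the two rows of a $2\times n_H$ grid; all deeper blocks are routed on single-row segments. Routing-added CNOT cost counts only CNOTs introduced by routing. A top-level two-row GPS block costs routing depth $3\mu_{\mathrm{jump}}2^{n_H}$; a single-row GPS or $\mathrm{GPS}^*$ block of high width $w$ at single-row recursion level $r$ costs routing depth $6\mu_{\mathrm{jump}}2^r2^{w}$; $O(1)$ boundary corrections per block are disregarded. $D^{\mathrm{GPF}\text{-}1\mathrm L}_{\mathrm{route}}(n,r)$ and $D^{\mathrm{GPF}^*\text{-}1\mathrm L}_{\mathrm{route}}(n,r)$ denote the routing-added CNOT depths of $\mathrm{GPF}(n)$ and $\mathrm{GPF}^*(n)$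 on a single row at recursion level $r$; $D^{\mathrm{GPF}\text{-}2\mathrm L}_{\mathrm{route}}(n)$ is that of the complete circuit with two-row top level.
   Formalization: The maximum at n=2^(λ+1)-1 in each dyadic interval is claimed for every λ except λ=3, where it is false: the normalized depth at n=11 (about 14.695 μ_jump) exceeds that at n=15 (about 13.953 μ_jump). *)

theory Defs
  imports "HOL-Analysis.Analysis"
begin

section \<open>Gray codes and jump density\<close>

definition cyclic_dist :: "nat \<Rightarrow> nat \<Rightarrow> nat \<Rightarrow> nat" where
  "cyclic_dist w a b = (let d = max a b - min a b in min d (w - d))"

text \<open>Vectors over the two-element field are represented by their supports; flipping coordinate
  \<open>i\<close> toggles membership of \<open>i\<close>.\<close>

definition gray_vertex :: "nat list \<Rightarrow> nat \<Rightarrow> nat set" where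
  "gray_vertex fs t = {i. odd (count_list (take t fs) i)}"

definition closed_gray_code :: "nat \<Rightarrow> nat list \<Rightarrow> bool" where
  "closed_gray_code w fs \<longleftrightarrow>
     length fs = 2 ^ w \<and>
     bij_betw (gray_vertex fs) {..<2 ^ w} (Pow {..<w}) \<and>
     gray_vertex fs (2 ^ w) = {}"

definition jump_density :: "nat \<Rightarrow> nat list \<Rightarrow> real" where
  "jump_density w fs =
     (\<Sum>t<2 ^ w. real (cyclic_dist w (fs ! t) (fs ! ((t + 1) mod 2 ^ w)))) / 2 ^ w"

text \<open>The routing model below takes one constant \<open>mu\<close> in place of the jump densities of all
  blocks. Such a constant is positive by the following fact, and positivity is the only
  restriction put on it.\<close>

lemma jump_density_pos:
  assumes gray: "closed_gray_code w fs" and w: "2 \<le> w"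
  shows "0 < jump_density w fs"
proof -
  have len: "length fs = 2 ^ w" and bij: "bij_betw (gray_vertex fs) {..<2 ^ w} (Pow {..<w})"
    and ret: "gray_vertex fs (2 ^ w) = {}"
    using gray by (auto simp: closed_gray_code_def)
  have "(2::nat) ^ 2 \<le> 2 ^ w"
    using w by (intro power_increasing) auto
  then have four: "(4::nat) \<le> 2 ^ w"
    by simp
  obtain a b gs where fs: "fs = a # b # gs"
    using len four by (cases fs; cases "tl fs") auto
  have "a \<noteq> b"
  proof
    assume "a = b"
    then have "gray_vertex fs 2 = gray_vertex fs 0"
      by (auto simp: gray_vertex_def fs numeral_2_eq_2)
    moreover have "inj_on (gray_vertex fs) {..<2 ^ w}"
      using bij by (rule bij_betw_imp_inj_on)
    ultimately have "(2::nat) = 0"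
      using four by (elim inj_onD) auto
    then show False
      by simp
  qed
  have v1: "gray_vertex fs 1 = {a}" and v2: "gray_vertex fs 2 = {a, b}"
    using \<open>a \<noteq> b\<close> by (auto simp: gray_vertex_def fs numeral_2_eq_2 split: if_splits)
  have "gray_vertex fs 2 \<in> Pow {..<w}"
    using bij four by (auto simp: bij_betw_def)
  then have "a < w" "b < w"
    using v2 by auto
  then have pos: "0 < cyclic_dist w (fs ! 0) (fs ! ((0 + 1) mod 2 ^ w))"
    using \<open>a \<noteq> b\<close> four by (auto simp: cyclic_dist_def fs Let_def)
  have "0 < (\<Sum>t<2 ^ w. real (cyclic_dist w (fs ! t) (fs ! ((t + 1) mod 2 ^ w))))"
    using pos by (intro sum_pos2[where i = 0]) auto
  then show ?thesis
    by (simp add: jump_density_def)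
qed


section \<open>The circuit families\<close>

definition n_high :: "nat \<Rightarrow> nat" where "n_high n = (n + 1) div 2"
definition n_low :: "nat \<Rightarrow> nat" where "n_low n = n div 2"

lemma n_high_less [simp]: "\<not> n \<le> 1 \<Longrightarrow> n_high n < n"
  by (simp add: n_high_def)

lemma n_low_less [simp]: "\<not> n \<le> 1 \<Longrightarrow> n_low n < n"
  by (simp add: n_low_def)

text \<open>In the recursive functions below the argument \<open>0\<close> never arises from a positive one; it
  shares the value of \<open>1\<close>.\<close>

fun depth_z_star :: "nat \<Rightarrow> nat" where
  "depth_z_star n =
     (if n \<le> 1 then 1
      else 2 ^ (n_high n - 1) * depth_z_star (n_low n) + depth_z_star (n_high n))"

datatype block_kind = GPS | GPS_star

text \<open>\<open>Compound k w m H L\<close> stands for \<open>m\<close> mixing blocks of kind \<open>k\<close> and high width \<open>w\<close>, a circuit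
  \<open>H\<close> on the high qubits and a circuit \<open>L\<close> on the low qubits.\<close>

datatype circuit =
    Single_Qubit
  | Compound block_kind nat nat circuit circuit

fun gpf_star :: "nat \<Rightarrow> circuit" where
  "gpf_star n =
     (if n \<le> 1 then Single_Qubit
      else Compound GPS_star (n_high n) (depth_z_star (n_low n))
             (gpf_star (n_high n)) (gpf_star (n_low n)))"

fun gpf :: "nat \<Rightarrow> circuit" where
  "gpf n =
     (if n \<le> 1 then Single_Qubit
      else Compound GPS (n_high n) (depth_z_star (n_low n))
             (gpf (n_high n)) (gpf_star (n_low n)))"

declare depth_z_star.simps [simp del] gpf_star.simps [simp del] gpf.simps [simp del]


section \<open>Routing-added CNOT depth\<close>

text \<open>\<open>Single_Row r\<close> is a single-row segment at single-row recursion level \<open>r\<close>.\<close>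

datatype placement = Two_Row | Single_Row nat

text \<open>The constants are \<open>3\<close> (CNOT depth of a SWAP) and, on a single row, \<open>3 * 2\<close>. A block of high
  width 1 acts on two adjacent qubits and has no jumps (\<open>cyclic_dist 1 0 0 = 0\<close>), so it needs no
  routing. GPS and \<open>GPS_star\<close> blocks have the same cost.\<close>

fun block_route_depth :: "real \<Rightarrow> placement \<Rightarrow> nat \<Rightarrow> real" where
  "block_route_depth mu Two_Row w = (if w \<le> 1 then 0 else 3 * mu * 2 ^ w)"
| "block_route_depth mu (Single_Row r) w = (if w \<le> 1 then 0 else 6 * mu * 2 ^ r * 2 ^ w)"

fun route_depth_row :: "real \<Rightarrow> nat \<Rightarrow> circuit \<Rightarrow> real" where
  "route_depth_row mu r Single_Qubit = 0"
| "route_depth_row mu r (Compound k w m H L) =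
     real m * block_route_depth mu (Single_Row r) w
       + route_depth_row mu (r + 1) H + route_depth_row mu (r + 1) L"

fun route_depth_grid :: "real \<Rightarrow> circuit \<Rightarrow> real" where
  "route_depth_grid mu Single_Qubit = 0"
| "route_depth_grid mu (Compound k w m H L) =
     real m * block_route_depth mu Two_Row w
       + route_depth_row mu 0 H + route_depth_row mu 0 L"

definition D_GPF_2L :: "real \<Rightarrow> nat \<Rightarrow> real" where
  "D_GPF_2L mu n = route_depth_grid mu (gpf n)"

definition D_GPF_1L :: "real \<Rightarrow> nat \<Rightarrow> nat \<Rightarrow> real" where
  "D_GPF_1L mu n r = route_depth_row mu r (gpf n)"

definition D_GPF_star_1L :: "real \<Rightarrow> nat \<Rightarrow> nat \<Rightarrow> real" where
  "D_GPF_star_1L mu n r = route_depth_row mu r (gpf_star n)"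

definition normalized_depth :: "real \<Rightarrow> nat \<Rightarrow> real" where
  "normalized_depth mu n = D_GPF_2L mu n / (2 ^ n / real n)"

text \<open>The product over \<open>j \<ge> 1\<close> of \<open>1 + 2 powr (1 - 2 ^ (j - 1))\<close>, indexed from \<open>0\<close>.\<close>

definition gpf_const :: real where
  "gpf_const = (\<Prod>j. 1 + 2 powr (1 - 2 ^ j))"

text \<open>In the dyadic interval from 8 to 15 the normalized depth is not maximal at 15.\<close>

lemma normalized_depth_15_less_11:
  assumes "0 < mu"
  shows "normalized_depth mu 15 < normalized_depth mu 11"
  using assms
  by (simp add: normalized_depth_def D_GPF_2L_def gpf.simps gpf_star.simps
      depth_z_star.simps n_high_def n_low_def)

end

theory Submission
  imports Defs
begin

text \<open>With \<open>d = depth_z_star\<close>, the term \<open>2 ^ n_high n * d (n_low n)\<close> of the recurrences is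
  \<open>2 * (d n - d (n_high n))\<close>. Hence the routing depth is \<open>6 * mu * d n\<close> up to an error of order
  \<open>2 ^ n_high n\<close>, and everything reduces to \<open>g n = d n / 2 ^ n\<close>, which satisfies
  \<open>g n = g (n_low n) / 2 + g (n_high n) / 2 ^ n_low n\<close>. So \<open>g\<close> depends essentially on the leading
  binary digits of \<open>n\<close>: a further digit halves it and adds a doubly exponentially small term. With
  \<open>P\<close> the partial products of \<open>gpf_const\<close>, the extreme digit strings give
  \<open>2 ^ k * g (2 ^ k) = P k / 2\<close> and \<open>2 ^ k * g (2 ^ k - 1) = P k - 1\<close>. Every other digit string
  stays away from them by a relative margin of order \<open>1 / 2 ^ l\<close> on the interval from \<open>2 ^ l\<close>,
  which dominates the error terms once \<open>l \<ge> 5\<close>; smaller \<open>l\<close> are computed.\<close>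

section \<open>Unrouted depth: doubled recursion and a first bound\<close>

lemma n_high_add_low: "n_high n + n_low n = n"
  by (simp add: n_high_def n_low_def)

lemma depth_z_star_le_one: "n \<le> 1 \<Longrightarrow> depth_z_star n = 1"
  by (simp add: depth_z_star.simps)

text \<open>Doubling removes the truncated exponent \<open>n_high n - 1\<close> and exposes the
  product \<open>2 ^ n_high n * depth_z_star (n_low n)\<close> that also drives the routing
  recurrences.\<close>

lemma depth_z_star_rec:
  assumes "2 \<le> n"
  shows "2 * depth_z_star n = 2 ^ n_high n * depth_z_star (n_low n) + 2 * depth_z_star (n_high n)"
proof -
  obtain h where "n_high n = Suc h"
    using assms by (cases "n_high n") (auto simp: n_high_def)
  then show ?thesis
    using assms by (subst depth_z_star.simps) (simp add: algebra_simps)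
qed

lemma depth_z_star_le: "1 \<le> n \<Longrightarrow> 2 * depth_z_star n \<le> 2 ^ n"
proof (induction n rule: less_induct)
  case (less n)
  show ?case
  proof (cases "n = 1")
    case True
    then show ?thesis by (simp add: depth_z_star_le_one)
  next
    case False
    then have n: "2 \<le> n" using less.prems by simp
    obtain b where b: "n_low n = Suc b"
      using n by (cases "n_low n") (auto simp: n_low_def)
    have lo: "2 * depth_z_star (n_low n) \<le> 2 ^ n_low n"
      using n by (intro less.IH) (auto simp: n_low_def)
    have hi: "2 * depth_z_star (n_high n) \<le> 2 ^ n_high n"
      using n by (intro less.IH) (auto simp: n_high_def)
    have "2 ^ n_high n * depth_z_star (n_low n) \<le> 2 ^ n_high n * 2 ^ b"
      using lo b by simp
    \<comment> \<open>The summand from the high half is at most \<open>2 ^ n_high n\<close>, which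
      fits into the second half of \<open>2 ^ n\<close>.\<close>
    moreover have "2 ^ n_high n * (1::nat) \<le> 2 ^ n_high n * 2 ^ b"
      by (intro mult_le_mono) auto
    moreover have "(2::nat) ^ n = 2 * (2 ^ n_high n * 2 ^ b)"
      using n_high_add_low[of n] b by (metis power_Suc power_add mult.left_commute)
    ultimately show ?thesis
      using depth_z_star_rec[OF n] hi by linarith
  qed
qed


section \<open>Reduction to an integer recurrence\<close>

text \<open>One integer sequence serves all three depths. The two single-row recurrences coincide,
  and raising the level from \<open>r\<close> to \<open>r + 1\<close> doubles every term, hence the
  factors 2. The single-row depths carry the prefactor \<open>2 * mu * 2 ^ r\<close>, and the
  cheaper two-row top level carries just \<open>mu\<close>.\<close>

fun route_coeff :: "nat \<Rightarrow> nat" where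
  "route_coeff n =
     (if n \<le> 2 then 0
      else 3 * 2 ^ n_high n * depth_z_star (n_low n)
        + 2 * route_coeff (n_high n) + 2 * route_coeff (n_low n))"

declare route_coeff.simps [simp del]

text \<open>The circuit on two qubits has only blocks of high width 1, and these are routed at no
  cost.\<close>

lemma D_GPF_star_1L_le_two:
  assumes "n \<le> 2"
  shows "D_GPF_star_1L mu n r = 0"
proof -
  consider "n \<le> 1" | "n = 2" using assms by linarith
  then show ?thesis
    by cases (simp_all add: D_GPF_star_1L_def gpf_star.simps n_high_def n_low_def)
qed

lemma D_GPF_1L_le_two:
  assumes "n \<le> 2"
  shows "D_GPF_1L mu n r = 0"
proof -
  consider "n \<le> 1" | "n = 2" using assms by linarith
  then show ?thesis
    by cases (simp_all add: D_GPF_1L_def gpf.simps gpf_star.simps n_high_def n_low_def)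
qed

lemma D_GPF_2L_le_two:
  assumes "n \<le> 2"
  shows "D_GPF_2L mu n = 0"
proof -
  consider "n \<le> 1" | "n = 2" using assms by linarith
  then show ?thesis
    by cases (simp_all add: D_GPF_2L_def gpf.simps gpf_star.simps n_high_def n_low_def)
qed

lemma D_GPF_star_1L_rec:
  assumes "2 < n"
  shows "D_GPF_star_1L mu n r =
    6 * mu * 2 ^ r * 2 ^ n_high n * real (depth_z_star (n_low n))
      + D_GPF_star_1L mu (n_high n) (r + 1) + D_GPF_star_1L mu (n_low n) (r + 1)"
proof -
  have "\<not> n_high n \<le> 1" using assms by (simp add: n_high_def)
  then show ?thesis
    using assms by (simp add: D_GPF_star_1L_def gpf_star.simps[of n])
qed

lemma D_GPF_1L_rec:
  assumes "2 < n"
  shows "D_GPF_1L mu n r =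
    6 * mu * 2 ^ r * 2 ^ n_high n * real (depth_z_star (n_low n))
      + D_GPF_1L mu (n_high n) (r + 1) + D_GPF_star_1L mu (n_low n) (r + 1)"
proof -
  have "\<not> n_high n \<le> 1" using assms by (simp add: n_high_def)
  then show ?thesis
    using assms by (simp add: D_GPF_1L_def D_GPF_star_1L_def gpf.simps[of n])
qed

lemma D_GPF_2L_rec:
  assumes "2 < n"
  shows "D_GPF_2L mu n =
    3 * mu * 2 ^ n_high n * real (depth_z_star (n_low n))
      + D_GPF_1L mu (n_high n) 0 + D_GPF_star_1L mu (n_low n) 0"
proof -
  have "\<not> n_high n \<le> 1" using assms by (simp add: n_high_def)
  then show ?thesis
    using assms by (simp add: D_GPF_2L_def D_GPF_1L_def D_GPF_star_1L_def gpf.simps[of n])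
qed

lemma D_GPF_star_1L_eq: "D_GPF_star_1L mu n r = 2 * mu * 2 ^ r * real (route_coeff n)"
proof (induction n arbitrary: r rule: less_induct)
  case (less n)
  show ?case
  proof (cases "n \<le> 2")
    case True
    then show ?thesis by (simp add: D_GPF_star_1L_le_two route_coeff.simps)
  next
    case False
    then show ?thesis
      by (simp add: D_GPF_star_1L_rec route_coeff.simps[of n] less.IH algebra_simps)
  qed
qed

lemma D_GPF_1L_eq: "D_GPF_1L mu n r = 2 * mu * 2 ^ r * real (route_coeff n)"
proof (induction n arbitrary: r rule: less_induct)
  case (less n)
  show ?case
  proof (cases "n \<le> 2")
    case True
    then show ?thesis by (simp add: D_GPF_1L_le_two route_coeff.simps)
  next
    case False
    then show ?thesis
      by (simp add: D_GPF_1L_rec D_GPF_star_1L_eq route_coeff.simps[of n] less.IH algebra_simps)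
  qed
qed

lemma D_GPF_2L_eq: "D_GPF_2L mu n = mu * real (route_coeff n)"
proof (cases "n \<le> 2")
  case True
  then show ?thesis by (simp add: D_GPF_2L_le_two route_coeff.simps)
next
  case False
  then show ?thesis
    by (simp add: D_GPF_2L_rec D_GPF_1L_eq D_GPF_star_1L_eq route_coeff.simps[of n] algebra_simps)
qed

definition norm_coeff :: "nat \<Rightarrow> real" where
  "norm_coeff n = real n * real (route_coeff n) / 2 ^ n"

lemma normalized_depth_eq: "normalized_depth mu n = mu * norm_coeff n"
  by (simp add: normalized_depth_def norm_coeff_def D_GPF_2L_eq)


section \<open>Values for small arguments\<close>

lemma depth_z_star_values:
  "depth_z_star (Suc 0) = 1"
  "depth_z_star 2 = 2" "depth_z_star 3 = 4" "depth_z_star 4 = 6" "depth_z_star 5 = 12"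
  "depth_z_star 6 = 20" "depth_z_star 7 = 38" "depth_z_star 8 = 54"
  by (simp_all add: depth_z_star.simps n_high_def n_low_def)

text \<open>The recursion equations are instantiated at numerals (and \<open>Suc 0\<close>, the
  simplifier's form of 1), so that rewriting evaluates concrete values and cannot loop on a symbolic
  argument.\<close>

lemmas small_values =
  depth_z_star_values depth_z_star.simps[of "numeral k" for k]
  route_coeff.simps[of "numeral k" for k] route_coeff.simps[of "Suc 0"]
  n_high_def n_low_def

lemma atLeastLessThan_numeral_16_32:
  "{16..<32::nat} = {16,17,18,19,20,21,22,23,24,25,26,27,28,29,30,31}"
  by (simp add: atLeastLessThan_upt del: set_upt)

lemma atLeastLessThan_numeral_1_15:
  "{Suc 0..<15} = {Suc 0,2,3,4,5,6,7,8,9,10,11,12,13,14}"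
  by (simp add: atLeastLessThan_upt upt_rec[of "Suc 0"] numeral_2_eq_2[symmetric] del: set_upt)

lemma norm_coeff_min_small:
  assumes "l \<le> 4" "n \<in> {2 ^ l<..<2 ^ (l + 1)}"
  shows "norm_coeff (2 ^ l) < norm_coeff n"
proof -
  consider "l = 0" | "l = 1" | "l = 2" | "l = 3" | "l = 4"
    using assms(1) by linarith
  then show ?thesis
  proof cases
    case 1
    then show ?thesis using assms(2) by simp
  next
    case 2
    then have "n = 3" using assms(2) by simp
    then show ?thesis using 2 by (simp add: norm_coeff_def small_values)
  next
    case 3
    then have "n = 5 \<or> n = 6 \<or> n = 7" using assms(2) by auto
    then show ?thesis using 3 by (elim disjE) (simp_all add: norm_coeff_def small_values)
  next
    case 4
    then have "n = 9 \<or> n = 10 \<or> n = 11 \<or> n = 12 \<or> n = 13 \<or> n = 14 \<or> n = 15"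
      using assms(2) by auto
    then show ?thesis using 4 by (elim disjE) (simp_all add: norm_coeff_def small_values)
  next
    case 5
    then have "n \<in> {16..<32}" "n \<noteq> 16" using assms(2) by auto
    then show ?thesis
      unfolding atLeastLessThan_numeral_16_32 using 5
      by (elim insertE) (simp_all add: norm_coeff_def small_values)
  qed
qed

text \<open>The case \<open>l = 3\<close> is excluded because the value at 11 exceeds the one at
  15.\<close>

lemma norm_coeff_max_small:
  assumes "l \<le> 4" "l \<noteq> 3" "n \<in> {2 ^ l..<2 ^ (l + 1) - 1}"
  shows "norm_coeff n < norm_coeff (2 ^ (l + 1) - 1)"
proof -
  consider "l = 0" | "l = 1" | "l = 2" | "l = 4"
    using assms(1,2) by linarith
  then show ?thesis
  proof cases
    case 1
    then show ?thesis using assms(3) by simp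
  next
    case 2
    then have "n = 2" using assms(3) by simp
    then show ?thesis using 2 by (simp add: norm_coeff_def small_values)
  next
    case 3
    then have "n = 4 \<or> n = 5 \<or> n = 6" using assms(3) by auto
    then show ?thesis using 3 by (elim disjE) (simp_all add: norm_coeff_def small_values)
  next
    case 4
    then have "n \<in> {16..<32}" "n \<noteq> 31" using assms(3) by auto
    then show ?thesis
      unfolding atLeastLessThan_numeral_16_32 using 4
      by (elim insertE) (simp_all add: norm_coeff_def small_values)
  qed
qed

text \<open>This is the falling edge of the sawtooth. It starts at \<open>l = 2\<close>: for
  \<open>l = 1\<close> the value rises from 4.5 at 3 to 6 at 4.\<close>

lemma norm_coeff_drop_small:
  assumes "2 \<le> l" "l \<le> 4"
  shows "norm_coeff (2 ^ (l + 1)) < norm_coeff (2 ^ (l + 1) - 1)"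
proof -
  consider "l = 2" | "l = 3" | "l = 4"
    using assms by linarith
  then show ?thesis
    by cases (simp_all add: norm_coeff_def small_values)
qed


section \<open>Comparison of the routing depth with the unrouted depth\<close>

text \<open>By the doubled recursion \<open>route_coeff n\<close> is
  \<open>6 * depth_z_star n - 6 * depth_z_star (n_high n)\<close> plus twice the coefficients of the
  halves, and the induction hypothesis for the high half pays for the subtracted term. The bound
  fails at 4, so 5 to 9 are computed; from 10 on the high half is at least 5.\<close>

lemma depth_z_star_le_route_coeff:
  "5 \<le> n \<Longrightarrow> 6 * depth_z_star n \<le> route_coeff n"
proof (induction n rule: less_induct)
  case (less n)
  show ?case
  proof (cases "n < 10")
    case True
    then have "n = 5 \<or> n = 6 \<or> n = 7 \<or> n = 8 \<or> n = 9" using less.prems by auto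
    then show ?thesis by (elim disjE) (simp_all add: small_values)
  next
    case False
    then have "6 * depth_z_star (n_high n) \<le> route_coeff (n_high n)"
      by (intro less.IH) (auto simp: n_high_def)
    then show ?thesis
      using False depth_z_star_rec[of n] by (simp add: route_coeff.simps[of n])
  qed
qed

text \<open>The constant 12 reproduces itself. With \<open>h\<close> and \<open>m\<close> the
  halves, the excess over \<open>6 * depth_z_star n\<close> is at most
  \<open>6 * depth_z_star h + 12 * depth_z_star m\<close> plus the two inherited errors. In units of
  \<open>2 ^ h\<close> these are at most 3, 6 and 3, the last because \<open>h \<ge> 8\<close> makes
  \<open>2 ^ n_high h\<close> at most a sixteenth of \<open>2 ^ h\<close>.\<close>

lemma route_coeff_le:
  "1 \<le> n \<Longrightarrow> route_coeff n \<le> 6 * depth_z_star n + 12 * 2 ^ n_high n"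
proof (induction n rule: less_induct)
  case (less n)
  show ?case
  proof (cases "n < 15")
    case True
    then have "n \<in> {Suc 0..<15}" using less.prems by simp
    then show ?thesis
      unfolding atLeastLessThan_numeral_1_15
      by (elim insertE) (simp_all add: small_values)
  next
    case False
    define h where "h = n_high n"
    define m where "m = n_low n"
    have hm: "8 \<le> h" "7 \<le> m" "h < n" "m < n" "m \<le> h"
      using False by (auto simp: h_def m_def n_high_def n_low_def)
    have hi: "route_coeff h \<le> 6 * depth_z_star h + 12 * 2 ^ n_high h"
      and lo: "route_coeff m \<le> 6 * depth_z_star m + 12 * 2 ^ n_high m"
      using hm by (auto intro!: less.IH)
    have dh: "2 * depth_z_star h \<le> 2 ^ h" and dm: "2 * depth_z_star m \<le> 2 ^ m"
      using hm by (auto intro!: depth_z_star_le)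
    have mh: "(2::nat) ^ m \<le> 2 ^ h" using hm by (intro power_increasing) auto
    have "(2::nat) ^ (n_high h + 4) \<le> 2 ^ h"
      using hm by (intro power_increasing) (auto simp: n_high_def)
    then have hh: "16 * (2::nat) ^ n_high h \<le> 2 ^ h" by (simp add: power_add)
    have hm': "(2::nat) ^ n_high m \<le> 2 ^ n_high h"
      using hm by (intro power_increasing) (auto simp: n_high_def)
    have "2 * depth_z_star n = 2 ^ h * depth_z_star m + 2 * depth_z_star h"
      using depth_z_star_rec[of n] False by (simp add: h_def m_def)
    moreover have "route_coeff n = 3 * (2 ^ h * depth_z_star m) + 2 * route_coeff h + 2 * route_coeff m"
      using False by (simp add: route_coeff.simps[of n] h_def m_def)
    ultimately show ?thesis
      using hi lo dh dm mh hh hm' unfolding h_def[symmetric] by linarith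
  qed
qed


section \<open>The scaled unrouted depth\<close>

definition scaled_depth :: "nat \<Rightarrow> real" where
  "scaled_depth n = real (depth_z_star n) / 2 ^ n"

lemma scaled_depth_nonneg: "0 \<le> scaled_depth n"
  by (simp add: scaled_depth_def)

lemma scaled_depth_le_half:
  assumes "1 \<le> n"
  shows "scaled_depth n \<le> 1 / 2"
proof -
  have "real (2 * depth_z_star n) \<le> real (2 ^ n)"
    using depth_z_star_le[OF assms] by (simp only: of_nat_le_iff)
  then show ?thesis by (simp add: scaled_depth_def field_simps)
qed

text \<open>This is the doubled recursion divided by \<open>2 * 2 ^ n\<close>. Since
  \<open>n_low n\<close> is \<open>n\<close> without its last binary digit, the first term is the
  effect of appending a digit and the second is a tiny correction.\<close>

lemma scaled_depth_rec:
  assumes "2 \<le> n"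
  shows "scaled_depth n = scaled_depth (n_low n) / 2 + scaled_depth (n_high n) / 2 ^ n_low n"
proof -
  have "2 * real (depth_z_star n) =
      2 ^ n_high n * real (depth_z_star (n_low n)) + 2 * real (depth_z_star (n_high n))"
    using arg_cong[OF depth_z_star_rec[OF assms], of real] by simp
  moreover have "(2::real) ^ n = 2 ^ n_high n * 2 ^ n_low n"
    using n_high_add_low[of n] by (metis power_add)
  ultimately show ?thesis
    by (simp add: scaled_depth_def field_simps)
qed

lemma scaled_depth_le_norm_coeff:
  assumes "5 \<le> n"
  shows "6 * (real n * scaled_depth n) \<le> norm_coeff n"
proof -
  have "real (6 * depth_z_star n) \<le> real (route_coeff n)"
    using depth_z_star_le_route_coeff[OF assms] by (simp only: of_nat_le_iff)
  then have "real n * real (6 * depth_z_star n) \<le> real n * real (route_coeff n)"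
    by (intro mult_left_mono) auto
  then show ?thesis
    by (simp add: norm_coeff_def scaled_depth_def field_simps)
qed

lemma norm_coeff_le:
  assumes "1 \<le> n"
  shows "norm_coeff n \<le> 6 * (real n * scaled_depth n) + 12 * real n / 2 ^ n_low n"
proof -
  have "real (route_coeff n) \<le> real (6 * depth_z_star n + 12 * 2 ^ n_high n)"
    using route_coeff_le[OF assms] by (simp only: of_nat_le_iff)
  then have "real n * real (route_coeff n) \<le> real n * (6 * real (depth_z_star n) + 12 * 2 ^ n_high n)"
    by (intro mult_left_mono) auto
  then have "norm_coeff n \<le> real n * (6 * real (depth_z_star n) + 12 * 2 ^ n_high n) / 2 ^ n"
    by (simp add: norm_coeff_def divide_right_mono)
  also have p: "(2::real) ^ n = 2 ^ n_high n * 2 ^ n_low n"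
    using n_high_add_low[of n] by (metis power_add)
  also have "real n * (6 * real (depth_z_star n) + 12 * 2 ^ n_high n) / (2 ^ n_high n * 2 ^ n_low n)
      = 6 * (real n * scaled_depth n) + 12 * real n / 2 ^ n_low n"
    unfolding scaled_depth_def p by (simp add: field_simps)
  finally show ?thesis .
qed


section \<open>Partial products\<close>

text \<open>The factors are those of \<open>gpf_const\<close>, written with natural-number powers so
  that they match the recursion of \<open>scaled_depth\<close>.\<close>

definition gpf_prod :: "nat \<Rightarrow> real" where
  "gpf_prod k = (\<Prod>i<k. 1 + 2 / 2 ^ (2 ^ i))"

lemma gpf_prod_Suc: "gpf_prod (Suc k) = gpf_prod k * (1 + 2 / 2 ^ (2 ^ k))"
  by (simp add: gpf_prod_def)

lemma gpf_prod_pos: "0 < gpf_prod k"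
  by (simp add: gpf_prod_def prod_pos add_pos_pos)

lemma gpf_prod_mono:
  assumes "j \<le> k"
  shows "gpf_prod j \<le> gpf_prod k"
  using assms
proof (rule lift_Suc_mono_le[rotated])
  show "gpf_prod n \<le> gpf_prod (Suc n)" for n
    using gpf_prod_pos[of n] by (simp add: gpf_prod_Suc algebra_simps)
qed

text \<open>With \<open>x = 2 / 2 ^ 2 ^ k\<close> the step is \<open>(1 + x) (1 + x\<^sup>2) \<le> 1 + 2 x\<close>, so \<open>gpf_prod k * (1 + 2 x)\<close>
  decreases to the same limit from above.\<close>

lemma gpf_prod_le:
  assumes "1 \<le> j" "j \<le> k"
  shows "gpf_prod k * (1 + 4 / 2 ^ (2 ^ k)) \<le> gpf_prod j * (1 + 4 / 2 ^ (2 ^ j))"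
  using assms(2)
proof (induction k rule: dec_induct)
  case base
  then show ?case by simp
next
  case (step k)
  define x :: real where "x = 1 / 2 ^ (2 ^ k)"
  have "(2::real) ^ 2 \<le> 2 ^ (2 ^ k)"
    using step.hyps assms(1) self_le_power[of 2 k] by (intro power_increasing) auto
  then have x: "0 < x" "x \<le> 1 / 4"
    by (auto simp: x_def field_simps)
  have "(2::real) ^ 2 ^ Suc k = (2 ^ (2 ^ k)) ^ 2"
    by (simp add: power_mult[symmetric] mult.commute)
  then have x2: "1 / 2 ^ (2 ^ Suc k) = x ^ 2"
    by (simp add: x_def power_divide)
  have "x * x \<le> 1 / 4 * (1 / 4)" using x by (intro mult_mono) auto
  then have "x * (4 * x + 8 * (x * x)) \<le> x * 2" using x by (intro mult_left_mono) auto
  then have "(1 + 2 * x) * (1 + 4 * x ^ 2) \<le> 1 + 4 * x"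
    by (simp add: algebra_simps power2_eq_square)
  then have "gpf_prod k * ((1 + 2 * x) * (1 + 4 * x ^ 2)) \<le> gpf_prod k * (1 + 4 * x)"
    using gpf_prod_pos[of k] by (intro mult_left_mono) auto
  also have "\<dots> \<le> gpf_prod j * (1 + 4 / 2 ^ (2 ^ j))"
    using step.IH by (simp add: x_def)
  also have "gpf_prod k * ((1 + 2 * x) * (1 + 4 * x ^ 2))
      = gpf_prod (Suc k) * (1 + 4 / 2 ^ (2 ^ Suc k))"
    unfolding gpf_prod_Suc x2[symmetric] by (simp add: x_def)
  finally show ?case .
qed

text \<open>The first three factors 2, 3/2 and 9/8 multiply to 3.375. Five factors already determine
  the limit to the accuracy used below.\<close>

lemma gpf_prod_5: "gpf_prod 5 = 3.375 * (129 / 128) * (32769 / 32768)"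
  by (simp add: gpf_prod_def eval_nat_numeral lessThan_Suc)

lemma gpf_prod_upper:
  assumes "5 \<le> k"
  shows "gpf_prod k \<le> 3.401472"
proof -
  have "gpf_prod k \<le> gpf_prod k * (1 + 4 / 2 ^ (2 ^ k))"
    using gpf_prod_pos[of k] by (simp add: algebra_simps)
  also have "\<dots> \<le> gpf_prod 5 * (1 + 4 / 2 ^ (2 ^ 5))"
    using assms by (intro gpf_prod_le) auto
  finally show ?thesis
    by (simp add: gpf_prod_5)
qed

lemma gpf_prod_lower:
  assumes "5 \<le> k"
  shows "3.40147 \<le> gpf_prod k"
  using gpf_prod_mono[OF assms] by (simp add: gpf_prod_5)

lemma gpf_prod_tendsto: "gpf_prod \<longlonglongrightarrow> gpf_const"
proof -
  have eq: "2 powr (1 - 2 ^ i) = 2 / (2::real) ^ (2 ^ i)" for i :: nat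
    by (simp add: powr_diff powr_realpow[symmetric])
  have "summable (\<lambda>i. 2 * (1 / 2 :: real) ^ i)"
    by (intro summable_mult summable_geometric) auto
  then have "summable (\<lambda>i. 2 / (2::real) ^ (2 ^ i))"
  proof (rule summable_comparison_test'[where N = 0])
    fix i :: nat
    have "(2::real) ^ i \<le> 2 ^ (2 ^ i)"
      using less_exp[of i] by (intro power_increasing) auto
    then show "norm (2 / (2::real) ^ (2 ^ i)) \<le> 2 * (1 / 2) ^ i"
      by (simp add: field_simps power_divide)
  qed
  moreover have "2 / (2::real) ^ (2 ^ i) \<noteq> - 1" for i :: nat
  proof -
    have "0 \<le> 2 / (2::real) ^ (2 ^ i)" by simp
    then show ?thesis by linarith
  qed
  ultimately have "convergent_prod (\<lambda>i. 1 + 2 / (2::real) ^ (2 ^ i))"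
    by (intro summable_imp_convergent_prod_real) simp_all
  then have "(\<lambda>n. \<Prod>i\<le>n. 1 + 2 / (2::real) ^ (2 ^ i)) \<longlonglongrightarrow> gpf_const"
    unfolding gpf_const_def eq by (rule convergent_prod_LIMSEQ)
  then have "(\<lambda>n. gpf_prod (Suc n)) \<longlonglongrightarrow> gpf_const"
    by (simp add: gpf_prod_def lessThan_Suc_atMost)
  then show ?thesis
    by (rule LIMSEQ_imp_Suc)
qed

section \<open>Exact values at powers of two and their predecessors\<close>

lemma n_low_high_simps:
  "n_low (2 ^ Suc k) = 2 ^ k" "n_high (2 ^ Suc k) = 2 ^ k"
  "n_low (2 ^ Suc k - 1) = 2 ^ k - 1" "n_high (2 ^ Suc k - 1) = 2 ^ k"
proof -
  obtain p where "2 ^ k = Suc p"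
    by (metis not0_implies_Suc power_not_zero zero_neq_numeral)
  then show "n_low (2 ^ Suc k) = 2 ^ k" "n_high (2 ^ Suc k) = 2 ^ k"
    "n_low (2 ^ Suc k - 1) = 2 ^ k - 1" "n_high (2 ^ Suc k - 1) = 2 ^ k"
    by (simp_all add: n_low_def n_high_def)
qed

text \<open>Both halves of \<open>2 ^ Suc k\<close> equal \<open>2 ^ k\<close>, so each step of the
  recursion contributes exactly one factor of the product.\<close>

lemma scaled_depth_power: "2 ^ k * scaled_depth (2 ^ k) = gpf_prod k / 2"
proof (induction k)
  case 0
  then show ?case by (simp add: scaled_depth_def depth_z_star_values gpf_prod_def)
next
  case (Suc k)
  have "scaled_depth (2 ^ Suc k) = scaled_depth (2 ^ k) * (1 + 2 / 2 ^ (2 ^ k)) / 2"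
    by (subst scaled_depth_rec) (simp_all only: n_low_high_simps, simp_all add: field_simps)
  then have "2 ^ Suc k * scaled_depth (2 ^ Suc k)
      = 2 ^ k * scaled_depth (2 ^ k) * (1 + 2 / 2 ^ (2 ^ k))"
    by simp
  then show ?case
    using Suc by (simp add: gpf_prod_Suc)
qed

text \<open>The low half is again a power minus one, while the high half is a power with known
  value. Its contribution is the increment of \<open>gpf_prod\<close>, so the sum telescopes. The
  index starts at \<open>Suc k\<close> because the identity fails at argument 0.\<close>

lemma scaled_depth_pred_power:
  "2 ^ Suc k * scaled_depth (2 ^ Suc k - 1) = gpf_prod (Suc k) - 1"
proof (induction k)
  case 0
  then show ?case by (simp add: scaled_depth_def depth_z_star_values gpf_prod_def)
next
  case (Suc k)
  define x where "x = scaled_depth (2 ^ Suc k)"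
  define y where "y = scaled_depth (2 ^ Suc k - 1)"
  have "(2::nat) ^ 2 \<le> 2 ^ Suc (Suc k)"
    by (intro power_increasing) auto
  then have ge: "2 \<le> (2::nat) ^ Suc (Suc k) - 1"
    unfolding power2_eq_square by linarith
  \<comment> \<open>This converts the exponent \<open>n_low n = 2 ^ Suc k - 1\<close> of the
    recursion into the exponent \<open>2 ^ Suc k\<close> of the product.\<close>
  have "(2::nat) ^ Suc k = Suc (2 ^ Suc k - 1)"
    by simp
  then have p: "2 ^ (2 ^ Suc k) = 2 * (2::real) ^ (2 ^ Suc k - 1)"
    by (metis power_Suc)
  have "scaled_depth (2 ^ Suc (Suc k) - 1) = y / 2 + x / 2 ^ (2 ^ Suc k - 1)"
    using scaled_depth_rec[OF ge] by (simp only: n_low_high_simps x_def y_def)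
  also have "x / 2 ^ (2 ^ Suc k - 1) = 2 * x / 2 ^ (2 ^ Suc k)"
    unfolding p by simp
  finally have e: "scaled_depth (2 ^ Suc (Suc k) - 1) = y / 2 + 2 * x / 2 ^ (2 ^ Suc k)" .
  have "2 ^ Suc (Suc k) * scaled_depth (2 ^ Suc (Suc k) - 1)
      = 2 ^ Suc k * y + 2 ^ Suc k * x * (4 / 2 ^ (2 ^ Suc k))"
    unfolding e by (simp add: algebra_simps)
  also have "\<dots> = gpf_prod (Suc k) - 1 + gpf_prod (Suc k) / 2 * (4 / 2 ^ (2 ^ Suc k))"
    using Suc scaled_depth_power[of "Suc k"] by (simp only: x_def y_def)
  also have "\<dots> = gpf_prod (Suc (Suc k)) - 1"
    by (simp add: gpf_prod_Suc[of "Suc k"] algebra_simps)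
  finally show ?case .
qed


section \<open>Extrema of the scaled depth within a dyadic interval\<close>

text \<open>With this bound, doubly exponential corrections fall below the margins of order
  \<open>1 / 2 ^ l\<close>. Equality holds at \<open>l = 4\<close>.\<close>

lemma double_add_le_power:
  assumes "4 \<le> l"
  shows "2 * l + 8 \<le> (2::nat) ^ l"
  using assms by (induction l rule: dec_induct) auto

text \<open>Induction on the number of binary digits, with a margin that is halved at each step. The
  halving leaves room for the growth of the minimum itself.\<close>

lemma scaled_depth_lower:
  "4 \<le> l \<Longrightarrow> n \<in> {2 ^ l<..<2 ^ (l + 1)} \<Longrightarrow>
    2 ^ l * scaled_depth (2 ^ l) * (1 + 1 / 2 ^ (l + 1)) \<le> real n * scaled_depth n"
proof (induction l arbitrary: n rule: dec_induct)
  case base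
  then have "n \<in> {16..<32}" "n \<noteq> 16" by auto
  then show ?case
    unfolding atLeastLessThan_numeral_16_32
    by (elim insertE) (simp_all add: scaled_depth_def small_values)
next
  case (step l)
  define m where "m = n_low n"
  define p where "p = 2 ^ l * scaled_depth (2 ^ l)"
  define x :: real where "x = 1 / 2 ^ (2 ^ l)"
  define y :: real where "y = 1 / 2 ^ (l + 2)"
  have p: "0 \<le> p" by (simp add: p_def scaled_depth_nonneg)
  have ge: "2 \<le> n"
    using step.prems by (auto intro: order_trans[of 2 "2 ^ Suc l"])
  have m: "2 ^ l \<le> m" "m < 2 ^ (l + 1)"
    using step.prems by (auto simp: m_def n_low_def)
  have "real n * scaled_depth m / 2 \<le> real n * scaled_depth n"
    using scaled_depth_rec[OF ge] scaled_depth_nonneg[of "n_high n"]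
    by (simp add: m_def mult_left_mono flip: times_divide_eq_right)
  moreover have "p * (1 + 2 * y) \<le> real n * scaled_depth m / 2"
  proof (cases "m = 2 ^ l")
    \<comment> \<open>Here \<open>n\<close> itself is not a power of two, so the appended digit is
      1. The weight \<open>n\<close> then exceeds \<open>2 * m\<close> by the factor
      \<open>1 + 2 * y\<close>, which is the required margin.\<close>
    case True
    have "n = 2 * 2 ^ l + 1"
      using step.prems True by (auto simp: m_def n_low_def)
    then have "real n * scaled_depth m / 2 = (2 * 2 ^ l + 1) * scaled_depth (2 ^ l) / 2"
      unfolding True by simp
    also have "\<dots> = p * (1 + 2 * y)"
      by (simp add: p_def y_def field_simps)
    finally show ?thesis by simp
  next
    case False
    then have "p * (1 + 2 * y) \<le> real m * scaled_depth m"
      using step.IH[of m] m by (simp add: p_def y_def)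
    also have "real m \<le> real n / 2"
      by (simp add: m_def n_low_def)
    finally show ?thesis
      using scaled_depth_nonneg[of m] by (simp add: mult_right_mono)
  qed
  \<comment> \<open>The minimum grows by \<open>1 + 2 * x\<close> from one interval to the next. As
    \<open>4 * x \<le> y\<close>, replacing the margin \<open>2 * y\<close> by \<open>y\<close>
    absorbs this.\<close>
  moreover have "p * ((1 + 2 * x) * (1 + y)) \<le> p * (1 + 2 * y)"
  proof -
    have "l + 4 \<le> 2 ^ l"
      using double_add_le_power[OF step.hyps(1)] by linarith
    then have "(2::real) ^ (l + 4) \<le> 2 ^ (2 ^ l)"
      by (intro power_increasing) auto
    then have x: "0 \<le> x" "4 * x \<le> y"
      by (auto simp: x_def y_def power_add field_simps)
    have "y \<le> 1"
      unfolding y_def by (simp only: divide_le_eq_1 one_le_power) simp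
    then have "x * y \<le> x * 1" using x by (intro mult_left_mono) auto
    then have "(1 + 2 * x) * (1 + y) \<le> 1 + 2 * y"
      using x by (simp add: algebra_simps)
    then show ?thesis using p by (intro mult_left_mono)
  qed
  moreover have "2 ^ Suc l * scaled_depth (2 ^ Suc l) = p * (1 + 2 * x)"
    by (simp only: scaled_depth_power gpf_prod_Suc p_def x_def) simp
  moreover have "1 / 2 ^ (Suc l + 1) = y"
    by (simp add: y_def)
  ultimately show ?case
    by (simp only: mult.assoc)
qed

text \<open>The weight is \<open>n + 1\<close> and not \<open>n\<close> because appending the binary digit 1 to \<open>n\<close> exactly
  doubles \<open>n + 1\<close>; only appending 0 loses a factor, and that loss outweighs all later corrections.\<close>

lemma scaled_depth_upper:
  "4 \<le> l \<Longrightarrow> n \<in> {2 ^ l..<2 ^ (l + 1) - 1} \<Longrightarrow>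
    (real n + 1) * scaled_depth n \<le> (gpf_prod (l + 1) - 1) * (1 - 1 / 2 ^ (l + 3))"
proof (induction l arbitrary: n rule: dec_induct)
  case base
  then have "n \<in> {16..<32}" "n \<noteq> 31" by auto
  then show ?case
    unfolding atLeastLessThan_numeral_16_32
    by (elim insertE) (simp_all add: scaled_depth_def small_values gpf_prod_5)
next
  case (step l)
  define m where "m = n_low n"
  define h where "h = gpf_prod (l + 1) - 1"
  \<comment> \<open>The deficit to be proved is \<open>y\<close>, and the induction hypothesis
    supplies \<open>2 * y\<close>. The difference \<open>h * y \<ge> 2 * y\<close> has to cover the
    high-half term, bounded below by \<open>y / 2\<close>.\<close>
  define y :: real where "y = 1 / 2 ^ (l + 4)"
  have ge: "2 \<le> n"
    using step.prems by (auto intro: order_trans[of 2 "2 ^ Suc l"])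
  have "gpf_prod 5 \<le> gpf_prod (l + 1)"
    using step.hyps by (intro gpf_prod_mono) auto
  then have h: "2 \<le> h" by (simp add: h_def gpf_prod_5)
  have y: "0 < y" "y \<le> 1 / 16"
    by (auto simp: y_def power_add field_simps)
  have m: "2 ^ l \<le> m" "m < 2 ^ (l + 1)"
    using step.prems by (auto simp: m_def n_low_def)
  have n: "real n + 1 \<le> 2 ^ (l + 2)"
  proof -
    have "n + 1 \<le> 2 ^ (l + 2)" using step.prems by auto
    then have "real (n + 1) \<le> real (2 ^ (l + 2))" by (simp only: of_nat_le_iff)
    then show ?thesis by simp
  qed
  have small: "(real n + 1) * (scaled_depth (n_high n) / 2 ^ m) \<le> y / 2"
  proof -
    have "2 * l + 8 \<le> m"
      using double_add_le_power[OF step.hyps(1)] m(1) by linarith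
    then have "(2::real) ^ (2 * l + 8) \<le> 2 ^ m"
      by (intro power_increasing) auto
    moreover have "scaled_depth (n_high n) \<le> 1 / 2"
      using ge by (intro scaled_depth_le_half) (auto simp: n_high_def)
    ultimately have "scaled_depth (n_high n) / 2 ^ m \<le> (1 / 2) / 2 ^ (2 * l + 8)"
      using scaled_depth_nonneg by (intro frac_le) auto
    then have "(real n + 1) * (scaled_depth (n_high n) / 2 ^ m)
        \<le> 2 ^ (l + 2) * ((1 / 2) / 2 ^ (2 * l + 8))"
      using n scaled_depth_nonneg by (intro mult_mono) auto
    also have "\<dots> = y / 8"
    proof -
      have e: "2 * l + 8 = (l + 2) + ((l + 4) + 2)" by simp
      show ?thesis
        unfolding e y_def power_add[of _ "l + 2"] power_add[of _ "l + 4"] by simp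
    qed
    finally show ?thesis using y by linarith
  qed
  have split: "(real n + 1) * scaled_depth n
      = (real n + 1) / 2 * scaled_depth m + (real n + 1) * (scaled_depth (n_high n) / 2 ^ m)"
    using scaled_depth_rec[OF ge] by (simp add: m_def algebra_simps)
  have "(real n + 1) / 2 * scaled_depth m \<le> h * (1 - 2 * y)"
  proof (cases "m = 2 ^ (l + 1) - 1")
    \<comment> \<open>All digits of \<open>m\<close> are 1 and the appended digit is 0, since
      \<open>n\<close> is not the excluded endpoint. This single 0 costs the factor
      \<open>1 - 4 * y\<close>.\<close>
    case True
    have 1: "(2::nat) ^ (l + 1) \<ge> 1" by simp
    have "n = 2 * m"
      using step.prems True by (auto simp: m_def n_low_def)
    then have "real n + 1 = 4 * 2 ^ l - 1"
      using True 1 by (simp add: of_nat_diff)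
    then have "(real n + 1) / 2 = 2 ^ (l + 1) * (1 - 4 * y)"
      unfolding y_def by (simp only:) (simp add: power_add field_simps)
    then have "(real n + 1) / 2 * scaled_depth m
        = 2 ^ (l + 1) * scaled_depth (2 ^ (l + 1) - 1) * (1 - 4 * y)"
      unfolding True by (simp only: mult_ac)
    also have "\<dots> = h * (1 - 4 * y)"
      using scaled_depth_pred_power[of l] by (simp add: h_def)
    also have "\<dots> \<le> h * (1 - 2 * y)"
      using h y by (intro mult_left_mono) auto
    finally show ?thesis .
  next
    case False
    have "real n \<le> 2 * real m + 1"
      by (simp add: m_def n_low_def)
    then have "(real n + 1) / 2 * scaled_depth m \<le> (real m + 1) * scaled_depth m"
      using scaled_depth_nonneg by (intro mult_right_mono) auto
    also have "\<dots> \<le> h * (1 - 2 * y)"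
    proof -
      have "m \<in> {2 ^ l..<2 ^ (l + 1) - 1}" using m False by auto
      then have "(real m + 1) * scaled_depth m \<le> h * (1 - 1 / 2 ^ (l + 3))"
        unfolding h_def by (rule step.IH)
      also have "1 / 2 ^ (l + 3) = 2 * y" by (simp add: y_def power_add)
      finally show ?thesis .
    qed
    finally show ?thesis .
  qed
  moreover have "2 * y \<le> h * y"
    using h y by (intro mult_right_mono) auto
  moreover have "h * (1 - 2 * y) + h * y = h * (1 - y)"
    by (simp add: algebra_simps)
  ultimately have "(real n + 1) * scaled_depth n \<le> h * (1 - y)"
    using small split y by linarith
  also have "\<dots> \<le> (gpf_prod (Suc l + 1) - 1) * (1 - y)"
    using y gpf_prod_mono[of "l + 1" "Suc l + 1"] by (intro mult_right_mono) (auto simp: h_def)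
  finally show ?case
    by (simp add: y_def power_add mult.commute)
qed

section \<open>Extrema and drops of the normalized depth\<close>

lemma norm_coeff_upper:
  assumes l: "5 \<le> l" and n: "n \<in> {2 ^ l..<2 ^ (l + 1)}"
  shows "norm_coeff n \<le> 6 * (real n * scaled_depth n) + 3 / 8 * (1 / 2 ^ l)"
proof -
  obtain k where k: "l = Suc k" "4 \<le> k"
    using l by (cases l) auto
  have m: "2 ^ k \<le> n_low n" using n by (auto simp: n_low_def k)
  then have "2 * k + 8 \<le> n_low n"
    using double_add_le_power[OF k(2)] by linarith
  then have "(2::real) ^ (2 * k + 8) \<le> 2 ^ n_low n"
    by (intro power_increasing) auto
  moreover have "12 * real n \<le> 12 * 2 ^ (l + 1)"
  proof -
    have "real n \<le> real (2 ^ (l + 1))" using n by (subst of_nat_le_iff) auto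
    then show ?thesis by simp
  qed
  \<comment> \<open>As \<open>2 * k + 8 = 2 * l + 6\<close>, the quotient on the right is
    \<open>12 / 2 ^ (l + 5)\<close>, which gives the constant 3/8.\<close>
  ultimately have "12 * real n / 2 ^ n_low n \<le> 12 * 2 ^ (l + 1) / 2 ^ (2 * k + 8)"
    by (intro frac_le) auto
  also have "\<dots> = 3 / 8 * (1 / 2 ^ l)"
  proof -
    have e: "2 * k + 8 = (l + 1) + (l + 5)" using k by simp
    show ?thesis
      unfolding e power_add[of _ "l + 1"] power_add[of _ l 5] by simp
  qed
  finally have "12 * real n / 2 ^ n_low n \<le> 3 / 8 * (1 / 2 ^ l)" .
  moreover have "1 \<le> n"
    using n one_le_power[of "2::nat" l] by auto
  ultimately show ?thesis
    using norm_coeff_le[of n] by linarith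
qed

text \<open>For \<open>l \<ge> 5\<close> and \<open>y = 1 / 2 ^ l\<close>, the margin of
  \<open>scaled_depth_lower\<close> contributes at least \<open>9 / 2 * y\<close>, against a routing
  error of at most \<open>3 / 8 * y\<close> at the power of two.\<close>

lemma norm_coeff_min:
  assumes n: "n \<in> {2 ^ l<..<2 ^ (l + 1)}"
  shows "norm_coeff (2 ^ l) < norm_coeff n"
proof (cases "l \<le> 4")
  case True
  then show ?thesis using n by (rule norm_coeff_min_small)
next
  case False
  then have l: "5 \<le> l" by simp
  define y :: real where "y = 1 / 2 ^ l"
  have y: "0 < y" by (simp add: y_def)
  have "5 \<le> n"
    using n l less_exp[of l] by (simp, linarith)
  then have "6 * (real n * scaled_depth n) \<le> norm_coeff n"
    by (rule scaled_depth_le_norm_coeff)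
  moreover have "gpf_prod l / 2 * (1 + y / 2) \<le> real n * scaled_depth n"
    using scaled_depth_lower[of l n] n l by (simp add: scaled_depth_power y_def mult.commute)
  moreover have "norm_coeff (2 ^ l) \<le> 6 * (gpf_prod l / 2) + 3 / 8 * y"
    using norm_coeff_upper[OF l, of "2 ^ l"] by (simp add: scaled_depth_power y_def)
  moreover have "3 * y \<le> gpf_prod l * y"
    using gpf_prod_lower[OF l] y by (intro mult_right_mono) auto
  moreover have "gpf_prod l / 2 * (1 + y / 2) = gpf_prod l / 2 + gpf_prod l * y / 4"
    by (simp add: algebra_simps)
  ultimately show ?thesis
    using y by linarith
qed

lemma norm_coeff_pred_power_lower:
  assumes l: "5 \<le> l"
  shows "6 * ((gpf_prod (l + 1) - 1) * (1 - 1 / 2 ^ (l + 1))) \<le> norm_coeff (2 ^ (l + 1) - 1)"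
proof -
  have "5 < (2::nat) ^ (l + 1)"
    using l less_exp[of "l + 1"] by linarith
  then have "6 * (real (2 ^ (l + 1) - 1) * scaled_depth (2 ^ (l + 1) - 1)) \<le> norm_coeff (2 ^ (l + 1) - 1)"
    by (intro scaled_depth_le_norm_coeff) linarith
  moreover have "real (2 ^ (l + 1) - 1) * scaled_depth (2 ^ (l + 1) - 1)
      = 2 ^ Suc l * scaled_depth (2 ^ Suc l - 1) * (1 - 1 / 2 ^ (l + 1))"
    by (simp add: of_nat_diff field_simps)
  ultimately show ?thesis
    by (simp only: scaled_depth_pred_power) simp
qed

text \<open>Passing from the weight \<open>n + 1\<close> back to \<open>n\<close> costs the factor
  \<open>n / (n + 1)\<close>, which is largest at the right endpoint, so the comparison keeps its
  direction. For \<open>l \<ge> 5\<close> the deficit from \<open>scaled_depth_upper\<close> is then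
  worth at least \<open>12 * y\<close>, against a routing error of \<open>3 * y\<close>.\<close>

lemma norm_coeff_max:
  assumes l3: "l \<noteq> 3" and n: "n \<in> {2 ^ l..<2 ^ (l + 1) - 1}"
  shows "norm_coeff n < norm_coeff (2 ^ (l + 1) - 1)"
proof (cases "l \<le> 4")
  case True
  then show ?thesis using l3 n by (rule norm_coeff_max_small)
next
  case False
  then have l: "5 \<le> l" by simp
  define y :: real where "y = 1 / 2 ^ (l + 3)"
  define h where "h = gpf_prod (l + 1) - 1"
  define q where "q = real n / (real n + 1)"
  have "(2::real) ^ 8 \<le> 2 ^ (l + 3)"
    using l by (intro power_increasing) auto
  then have y: "0 < y" "y \<le> 1 / 256"
    by (auto simp: y_def field_simps)
  have h: "2.4 \<le> h"
    using gpf_prod_lower[of "l + 1"] l by (simp add: h_def)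
  have "real (n + 1) \<le> real (2 ^ (l + 1))" using n by (subst of_nat_le_iff) auto
  then have "1 / 2 ^ (l + 1) \<le> 1 / (real n + 1)" by (intro divide_left_mono) auto
  then have q: "0 \<le> q" "q \<le> 1 - 4 * y"
    by (auto simp: q_def y_def power_add field_simps)
  have "real n * scaled_depth n = q * ((real n + 1) * scaled_depth n)"
    by (simp add: q_def)
  also have "\<dots> \<le> q * (h * (1 - y))"
    using scaled_depth_upper[of l n] n l q by (intro mult_left_mono) (auto simp: h_def y_def)
  also have "\<dots> \<le> (1 - 4 * y) * (h * (1 - y))"
    using q h y by (intro mult_right_mono) auto
  also have "\<dots> = h * (1 - 4 * y) - (h * (1 - 4 * y)) * y"
    by (simp add: algebra_simps)
  finally have "real n * scaled_depth n \<le> h * (1 - 4 * y) - (h * (1 - 4 * y)) * y" .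
  moreover have "2 * y \<le> (h * (1 - 4 * y)) * y"
  proof -
    have "2.4 * (1 - 4 / 256) \<le> h * (1 - 4 * y)"
      using h y by (intro mult_mono) auto
    then show ?thesis using y by (intro mult_right_mono) auto
  qed
  moreover have "norm_coeff n \<le> 6 * (real n * scaled_depth n) + 3 * y"
  proof -
    have "3 / 8 * (1 / 2 ^ l) = 3 * y" by (simp add: y_def power_add)
    moreover have "n \<in> {2 ^ l..<2 ^ (l + 1)}" using n by auto
    ultimately show ?thesis using norm_coeff_upper[OF l, of n] by simp
  qed
  moreover have "6 * (h * (1 - 4 * y)) \<le> norm_coeff (2 ^ (l + 1) - 1)"
    using norm_coeff_pred_power_lower[OF l] by (simp add: h_def y_def power_add)
  ultimately show ?thesis
    using y by linarith
qed

text \<open>The two sides are close to \<open>3 * gpf_const\<close> and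
  \<open>6 * (gpf_const - 1)\<close>, about 10.2 and 14.4, so crude bounds suffice for
  \<open>l \<ge> 5\<close>.\<close>

lemma norm_coeff_drop:
  assumes "2 \<le> l"
  shows "norm_coeff (2 ^ (l + 1)) < norm_coeff (2 ^ (l + 1) - 1)"
proof (cases "l \<le> 4")
  case True
  then show ?thesis using assms by (intro norm_coeff_drop_small)
next
  case False
  then have l: "5 \<le> l" by simp
  define y :: real where "y = 1 / 2 ^ (l + 1)"
  have "(2::real) ^ 6 \<le> 2 ^ (l + 1)"
    using l by (intro power_increasing) auto
  then have y: "0 < y" "y \<le> 1 / 64"
    by (auto simp: y_def field_simps)
  have "norm_coeff (2 ^ (l + 1)) \<le> 6 * (gpf_prod (l + 1) / 2) + 3 / 8 * y"
    using norm_coeff_upper[of "l + 1" "2 ^ (l + 1)"] l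
    by (simp only: of_nat_power of_nat_numeral scaled_depth_power y_def) simp
  moreover have "6 * ((gpf_prod (l + 1) - 1) * (1 - y)) \<le> norm_coeff (2 ^ (l + 1) - 1)"
    using norm_coeff_pred_power_lower[OF l] by (simp add: y_def)
  moreover have "2.4 * (1 - 1 / 64) \<le> (gpf_prod (l + 1) - 1) * (1 - y)"
    using gpf_prod_lower[of "l + 1"] l y by (intro mult_mono) auto
  ultimately show ?thesis
    using gpf_prod_upper[of "l + 1"] l y by simp
qed


section \<open>Limits\<close>

lemma tendsto_inverse_power_2: "(\<lambda>l. c * (1 / 2 ^ l)) \<longlonglongrightarrow> (0::real)"
  using LIMSEQ_divide_realpow_zero[of 2 c] by simp

lemma norm_coeff_power_tendsto: "(\<lambda>l. norm_coeff (2 ^ l)) \<longlonglongrightarrow> 3 * gpf_const"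
proof (rule tendsto_sandwich)
  show "(\<lambda>l. 3 * gpf_prod l) \<longlonglongrightarrow> 3 * gpf_const"
    by (intro tendsto_intros gpf_prod_tendsto)
  show "(\<lambda>l. 3 * gpf_prod l + 3 / 8 * (1 / 2 ^ l)) \<longlonglongrightarrow> 3 * gpf_const"
    using tendsto_add[OF tendsto_mult[OF tendsto_const[of 3] gpf_prod_tendsto]
        tendsto_inverse_power_2[of "3 / 8"]]
    by simp
  show "\<forall>\<^sub>F l in sequentially. 3 * gpf_prod l \<le> norm_coeff (2 ^ l)"
    using eventually_ge_at_top[of 5]
  proof eventually_elim
    case (elim l)
    have "5 \<le> (2::nat) ^ l" using elim less_exp[of l] by linarith
    then show ?case
      using scaled_depth_le_norm_coeff[of "2 ^ l"] by (simp add: scaled_depth_power)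
  qed
  show "\<forall>\<^sub>F l in sequentially. norm_coeff (2 ^ l) \<le> 3 * gpf_prod l + 3 / 8 * (1 / 2 ^ l)"
    using eventually_ge_at_top[of 5]
  proof eventually_elim
    case (elim l)
    then show ?case
      using norm_coeff_upper[of l "2 ^ l"] by (simp add: scaled_depth_power)
  qed
qed

lemma norm_coeff_pred_power_tendsto:
  "(\<lambda>l. norm_coeff (2 ^ l - 1)) \<longlonglongrightarrow> 3 * (2 * (gpf_const - 1))"
proof -
  have prod: "(\<lambda>l. gpf_prod (l + 1)) \<longlonglongrightarrow> gpf_const"
    using gpf_prod_tendsto by (rule LIMSEQ_ignore_initial_segment)
  have "(\<lambda>l. norm_coeff (2 ^ (l + 1) - 1)) \<longlonglongrightarrow> 6 * (gpf_const - 1)"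
  proof (rule tendsto_sandwich)
    have "(\<lambda>l. 1 - 1 / 2 * (1 / 2 ^ l)) \<longlonglongrightarrow> 1 - (0::real)"
      by (rule tendsto_diff[OF tendsto_const tendsto_inverse_power_2])
    from tendsto_mult[OF tendsto_const tendsto_mult[OF tendsto_diff[OF prod tendsto_const] this]]
    have "(\<lambda>l. 6 * ((gpf_prod (l + 1) - 1) * (1 - 1 / 2 * (1 / 2 ^ l))))
        \<longlonglongrightarrow> 6 * ((gpf_const - 1) * (1 - 0))" .
    then show "(\<lambda>l. 6 * ((gpf_prod (l + 1) - 1) * (1 - 1 / 2 ^ (l + 1)))) \<longlonglongrightarrow> 6 * (gpf_const - 1)"
      by simp
    have "(\<lambda>l. 6 * (gpf_prod (l + 1) - 1) + 3 / 8 * (1 / 2 ^ l)) \<longlonglongrightarrow> 6 * (gpf_const - 1) + 0"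
      by (intro tendsto_add[OF _ tendsto_inverse_power_2] tendsto_mult tendsto_const tendsto_diff prod)
    then show "(\<lambda>l. 6 * (gpf_prod (l + 1) - 1) + 3 / 8 * (1 / 2 ^ l)) \<longlonglongrightarrow> 6 * (gpf_const - 1)"
      by simp
    show "\<forall>\<^sub>F l in sequentially.
        6 * ((gpf_prod (l + 1) - 1) * (1 - 1 / 2 ^ (l + 1))) \<le> norm_coeff (2 ^ (l + 1) - 1)"
      using eventually_ge_at_top[of 5] by eventually_elim (rule norm_coeff_pred_power_lower)
    show "\<forall>\<^sub>F l in sequentially.
        norm_coeff (2 ^ (l + 1) - 1) \<le> 6 * (gpf_prod (l + 1) - 1) + 3 / 8 * (1 / 2 ^ l)"
      using eventually_ge_at_top[of 5]
    proof eventually_elim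
      case (elim l)
      define N where "N = (2::nat) ^ (l + 1) - 1"
      have "2 ^ l \<le> N \<and> N < 2 ^ (l + 1)"
        using one_le_power[of "2::nat" l] by (simp add: N_def)
      then have "norm_coeff N \<le> 6 * (real N * scaled_depth N) + 3 / 8 * (1 / 2 ^ l)"
        using elim by (intro norm_coeff_upper) auto
      \<comment> \<open>Raising the weight from \<open>N\<close> to \<open>N + 1 = 2 ^ Suc l\<close>
        brings in the exact value of \<open>scaled_depth_pred_power\<close>.\<close>
      also have "real N * scaled_depth N \<le> 2 ^ Suc l * scaled_depth N"
        using scaled_depth_nonneg by (intro mult_right_mono) (auto simp: N_def of_nat_diff)
      also have "\<dots> = gpf_prod (l + 1) - 1"
        using scaled_depth_pred_power[of l] by (simp add: N_def)
      finally show ?case by (simp add: N_def)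
    qed
  qed
  then have "(\<lambda>l. norm_coeff (2 ^ l - 1)) \<longlonglongrightarrow> 6 * (gpf_const - 1)"
    by (rule LIMSEQ_offset)
  then show ?thesis by simp
qed

section \<open>Numerical enclosure of the constant and assembly\<close>

lemma gpf_const_bounds: "3.40147 \<le> gpf_const" "gpf_const \<le> 3.401472"
  using LIMSEQ_le_const[OF gpf_prod_tendsto, of "3.40147"] gpf_prod_lower
    LIMSEQ_le_const2[OF gpf_prod_tendsto, of "3.401472"] gpf_prod_upper
  by blast+

theorem theorem5:
  fixes mu :: real
  assumes "0 < mu"
  shows
    "(\<forall>n>2. D_GPF_2L mu n =
        3 * mu * 2 ^ n_high n * real (depth_z_star (n_low n))
        + D_GPF_1L mu (n_high n) 0 + D_GPF_star_1L mu (n_low n) 0)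
     \<and> (\<forall>n>2. \<forall>r. D_GPF_1L mu n r =
        6 * mu * 2 ^ r * 2 ^ n_high n * real (depth_z_star (n_low n))
        + D_GPF_1L mu (n_high n) (r + 1) + D_GPF_star_1L mu (n_low n) (r + 1))
     \<and> (\<forall>n>2. \<forall>r. D_GPF_star_1L mu n r =
        6 * mu * 2 ^ r * 2 ^ n_high n * real (depth_z_star (n_low n))
        + D_GPF_star_1L mu (n_high n) (r + 1) + D_GPF_star_1L mu (n_low n) (r + 1))
     \<and> (\<forall>n\<le>2. D_GPF_2L mu n = 0 \<and> (\<forall>r. D_GPF_1L mu n r = 0 \<and> D_GPF_star_1L mu n r = 0))
     \<and> (\<forall>l. \<forall>n\<in>{2 ^ l<..<2 ^ (l + 1)}. normalized_depth mu (2 ^ l) < normalized_depth mu n)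
     \<and> (\<forall>l. l \<noteq> 3 \<longrightarrow> (\<forall>n\<in>{2 ^ l..<2 ^ (l + 1) - 1}.
          normalized_depth mu n < normalized_depth mu (2 ^ (l + 1) - 1)))
     \<and> (\<forall>l\<ge>2. normalized_depth mu (2 ^ (l + 1)) < normalized_depth mu (2 ^ (l + 1) - 1))
     \<and> (\<lambda>l. normalized_depth mu (2 ^ l)) \<longlonglongrightarrow> 3 * mu * gpf_const
     \<and> (\<lambda>l. normalized_depth mu (2 ^ l - 1)) \<longlonglongrightarrow> 3 * mu * (2 * (gpf_const - 1))
     \<and> \<bar>gpf_const - 3.40147\<bar> \<le> 0.000005
     \<and> \<bar>3 * 1.06 * gpf_const - 10.82\<bar> \<le> 0.005
     \<and> \<bar>3 * 1.06 * (2 * (gpf_const - 1)) - 15.27\<bar> \<le> 0.005"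
proof (intro conjI allI ballI impI)
  fix n r :: nat
  assume n: "2 < n"
  show "D_GPF_2L mu n =
        3 * mu * 2 ^ n_high n * real (depth_z_star (n_low n))
        + D_GPF_1L mu (n_high n) 0 + D_GPF_star_1L mu (n_low n) 0"
    using n by (rule D_GPF_2L_rec)
  show "D_GPF_1L mu n r =
        6 * mu * 2 ^ r * 2 ^ n_high n * real (depth_z_star (n_low n))
        + D_GPF_1L mu (n_high n) (r + 1) + D_GPF_star_1L mu (n_low n) (r + 1)"
    using n by (rule D_GPF_1L_rec)
  show "D_GPF_star_1L mu n r =
        6 * mu * 2 ^ r * 2 ^ n_high n * real (depth_z_star (n_low n))
        + D_GPF_star_1L mu (n_high n) (r + 1) + D_GPF_star_1L mu (n_low n) (r + 1)"
    using n by (rule D_GPF_star_1L_rec)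
next
  fix n r :: nat
  assume n: "n \<le> 2"
  show "D_GPF_2L mu n = 0" "D_GPF_1L mu n r = 0" "D_GPF_star_1L mu n r = 0"
    using n by (simp_all add: D_GPF_2L_le_two D_GPF_1L_le_two D_GPF_star_1L_le_two)
next
  fix l n :: nat
  assume "n \<in> {2 ^ l<..<2 ^ (l + 1)}"
  then show "normalized_depth mu (2 ^ l) < normalized_depth mu n"
    using assms norm_coeff_min by (simp add: normalized_depth_eq)
next
  fix l n :: nat
  assume "l \<noteq> 3" "n \<in> {2 ^ l..<2 ^ (l + 1) - 1}"
  then show "normalized_depth mu n < normalized_depth mu (2 ^ (l + 1) - 1)"
    unfolding normalized_depth_eq using assms by (intro mult_strict_left_mono norm_coeff_max)
next
  fix l :: nat
  assume "2 \<le> l"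
  then show "normalized_depth mu (2 ^ (l + 1)) < normalized_depth mu (2 ^ (l + 1) - 1)"
    unfolding normalized_depth_eq using assms by (intro mult_strict_left_mono norm_coeff_drop)
next
  show "(\<lambda>l. normalized_depth mu (2 ^ l)) \<longlonglongrightarrow> 3 * mu * gpf_const"
    using tendsto_mult_left[OF norm_coeff_power_tendsto, of mu]
    by (simp add: normalized_depth_eq mult_ac)
  show "(\<lambda>l. normalized_depth mu (2 ^ l - 1)) \<longlonglongrightarrow> 3 * mu * (2 * (gpf_const - 1))"
    using tendsto_mult_left[OF norm_coeff_pred_power_tendsto, of mu]
    by (simp only: normalized_depth_eq mult_ac)
  show "\<bar>gpf_const - 3.40147\<bar> \<le> 0.000005"
    "\<bar>3 * 1.06 * gpf_const - 10.82\<bar> \<le> 0.005"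
    "\<bar>3 * 1.06 * (2 * (gpf_const - 1)) - 15.27\<bar> \<le> 0.005"
    using gpf_const_bounds by (simp_all add: abs_le_iff)
qed

end
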